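(* Let $g_1,\ldots,g_m\in\mathbb{R}[x]$ and $\mathbf{K}=\{x\in\mathbb{R}^n:g_j(x)\geq0,\ j=1,\ldots,m\}$. Assume that $\mathbf{K}$ is compact, that the polynomial $x\mapsto a^2-\|x\|^2$ belongs to the quadratic module $Q(g)$ for some $a\in\mathbb{R}$, and that $\mathbf{K}\subset\mathbf{B}\subseteq[-1,1]^n$ with $\mathbf{B}$ a Borel set. Let $w:\mathbb{R}^n\to\mathbb{R}$ be a nonnegative measurable weight function such that the Borel measure $d\mu_2=w\,dx$ on $\mathbf{B}$ has (finite) moments $$y_{2\alpha}=\int_{\mathbf{B}}x^\alpha\,d\mu_2=\int_{\mathbf{B}}x^\alpha w(x)\,dx,\qquad\alpha\in\mathbb{N}^n,$$ and let $\mathbf{y}_2=(y_{2\alpha})$. Let $f\in\mathbb{R}[x]$ be a nonnegative polynomial and $$J^*:=\int_{\mathbf{K}}f(x)\,w(x)\,dx.$$ Put $r_0=\lceil(\deg f)/2\rceil$ and $r_j=\lceil(\deg g_j)/2\rceil$ for $j=1,\ldots,m$, and for every integer $d\geq\max_{0\leq j\leq m}r_j$ consider the semidefinite program $$\mathrm{Q}_d:\quad\left\{\begin{array}{lll}\displaystyle\sup_{\mathbf{y}_1}&L_{\mathbf{y}_1}(f)&\\ \text{s.t.}&M_d(\mathbf{y}_1)&\succeq0\\ &M_d(\mathbf{y}_2-\mathbf{y}_1)&\succeq0\\ &M_{d-r_j}(g_j\,\mathbf{y}_1)&\succeq0,\qquad j=1,\ldots,m,\end{array}\right.$$ where the unknown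 is $\mathbf{y}_1=(y_{1\alpha})_{|\alpha|\leq2d}$ with real entries. Then $\mathrm{Q}_d$ is solvable (i.e. has an optimal solution, with optimal value denoted $\max\mathrm{Q}_d$) and $\max\mathrm{Q}_d\downarrow J^*$ as $d\to\infty$ (monotone non-increasing convergence).
   Context: $\mathbb{R}[x]$ is the ring of real polynomials in $x=(x_1,\ldots,x_n)$ and $\Sigma^2[x]\subset\mathbb{R}[x]$ is the set of sums of squares of polynomials. The quadratic module generated by $g_1,\ldots,g_m$ is $Q(g)=\{\sigma_0+\sum_{j=1}^m\sigma_jg_j:\sigma_0,\ldots,\sigma_m\in\Sigma^2[x]\}$. For $\alpha\in\mathbb{N}^n$, $|\alpha|=\sum_i\alpha_i$ and $\mathbb{N}^n_d=\{\alpha\in\mathbb{N}^n:|\alpha|\leq d\}$. For a real family $\mathbf{y}=(y_\alpha)$ indexed by exponents, $L_{\mathbf{y}}$ is the linear functional $L_{\mathbf{y}}(\sum_\alpha f_\alpha x^\alpha)=\sum_\alpha f_\alpha y_\alpha$. The moment matrix $M_d(\mathbf{y})$ is the symmetric matrix indexed by $\alpha,\beta\in\mathbb{N}^n_d$ with entries $M_d(\mathbf{y})(\alpha,\beta)=y_{\alpha+\beta}$. For $g=\sum_\gamma g_\gamma x^\gamma\in\mathbb{R}[x]$, the localizing matrix $M_d(g\,\mathbf{y})$ is the symmetric matrix indexed by $\alpha,\beta\in\mathbb{N}^n_d$ with entries $L_{\mathbf{y}}(g(x)x^{\alpha+\beta})=\sum_\gamma g_\gamma y_{\alpha+\beta+\gamma}$.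 $A\succeq0$ means $A$ is positive semidefinite. In $M_d(\mathbf{y}_2-\mathbf{y}_1)$, $\mathbf{y}_2$ is truncated to $|\alpha|\le 2d$. *)

theory Defs
  imports "HOL-Analysis.Analysis" "HOL-Library.Poly_Mapping"
begin

type_synonym 'n mexp = "'n \<Rightarrow>\<^sub>0 nat"

text \<open>
  Real polynomials in variables indexed by \<open>'n\<close>: finitely supported maps from exponents to
  coefficients, with the convolution product of the library.
\<close>
type_synonym 'n rpoly = "'n mexp \<Rightarrow>\<^sub>0 real"

definition mdeg :: "'n::finite mexp \<Rightarrow> nat" where
  "mdeg \<alpha> = (\<Sum>i\<in>UNIV. Poly_Mapping.lookup \<alpha> i)"

definition exps :: "nat \<Rightarrow> 'n::finite mexp set" where
  "exps d = {\<alpha>. mdeg \<alpha> \<le> d}"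

definition xpow :: "'n::finite mexp \<Rightarrow> real^'n \<Rightarrow> real" where
  "xpow \<alpha> x = (\<Prod>i\<in>UNIV. (x $ i) ^ Poly_Mapping.lookup \<alpha> i)"

definition peval :: "'n::finite rpoly \<Rightarrow> real^'n \<Rightarrow> real" where
  "peval p x = (\<Sum>\<alpha>\<in>Poly_Mapping.keys p. Poly_Mapping.lookup p \<alpha> * xpow \<alpha> x)"

text \<open>The zero polynomial gets degree 0.\<close>
definition pdeg :: "'n::finite rpoly \<Rightarrow> nat" where
  "pdeg p = Max (insert 0 (mdeg ` Poly_Mapping.keys p))"

definition half_deg :: "'n::finite rpoly \<Rightarrow> nat" where
  "half_deg p = nat \<lceil>real (pdeg p) / 2\<rceil>"

definition sos :: "'n::finite rpoly set" where
  "sos = {\<Sum>p\<leftarrow>ps. p ^ 2 | ps. True}"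

definition quadratic_module :: "nat \<Rightarrow> (nat \<Rightarrow> 'n::finite rpoly) \<Rightarrow> 'n rpoly set" where
  "quadratic_module m g =
     {\<sigma> 0 + (\<Sum>j=1..m. \<sigma> j * g j) | \<sigma>. \<forall>j\<in>{0..m}. \<sigma> j \<in> sos}"

text \<open>The polynomial \<open>a\<^sup>2 - (x\<^sub>1\<^sup>2 + \<dots> + x\<^sub>n\<^sup>2)\<close>.\<close>
definition ball_poly :: "real \<Rightarrow> 'n::finite rpoly" where
  "ball_poly a = Poly_Mapping.single 0 (a\<^sup>2)
     - (\<Sum>i\<in>UNIV. Poly_Mapping.single (Poly_Mapping.single i 2) 1)"

lemma peval_diff: "peval (p - q) x = peval p x - peval q x"
proof -
  let ?S = "Poly_Mapping.keys p \<union> Poly_Mapping.keys q"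
  have *: "peval r x = (\<Sum>\<alpha>\<in>?S. Poly_Mapping.lookup r \<alpha> * xpow \<alpha> x)"
    if "Poly_Mapping.keys r \<subseteq> ?S" for r
    unfolding peval_def using that
    by (intro sum.mono_neutral_left) (auto simp: in_keys_iff)
  have "Poly_Mapping.keys (p - q) \<subseteq> ?S"
    by (auto simp: in_keys_iff lookup_minus)
  then show ?thesis
    by (simp add: * lookup_minus algebra_simps sum_subtractf)
qed

lemma peval_add: "peval (p + q) x = peval p x + peval q x"
proof -
  have "peval (0 - q) x = - peval q x" for q
    by (subst peval_diff) (simp add: peval_def)
  then show ?thesis
    using peval_diff[of p "0 - q" x] by simp
qed

lemma peval_ball_poly: "peval (ball_poly a) x = a\<^sup>2 - (norm x)\<^sup>2"
proof -
  have s: "peval (Poly_Mapping.single \<alpha> c) x = c * xpow \<alpha> x" for \<alpha> c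
    by (cases "c = 0") (auto simp: peval_def)
  have "peval (sum h A) x = (\<Sum>i\<in>A. peval (h i) x)" if "finite A" for h and A :: "'a set"
    using that by induction (simp_all add: peval_add, simp add: peval_def)
  moreover have "xpow (Poly_Mapping.single i 2) x = (x $ i)\<^sup>2" for i
  proof -
    have "xpow (Poly_Mapping.single i 2) x = (\<Prod>k\<in>UNIV. if k = i then (x $ k)\<^sup>2 else 1)"
      unfolding xpow_def by (rule prod.cong) (auto simp: lookup_single when_def)
    then show ?thesis by simp
  qed
  ultimately show ?thesis
    unfolding ball_poly_def
    by (simp add: peval_diff s norm_vec_def L2_set_def sum_nonneg) (simp add: xpow_def)
qed

definition semialg :: "nat \<Rightarrow> (nat \<Rightarrow> 'n::finite rpoly) \<Rightarrow> (real^'n) set" where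
  "semialg m g = {x. \<forall>j\<in>{1..m}. 0 \<le> peval (g j) x}"

text \<open>Moments of the measure on \<open>B\<close> with density \<open>w\<close> with respect to Lebesgue measure.\<close>
definition moments :: "(real^'n::finite) set \<Rightarrow> (real^'n \<Rightarrow> real) \<Rightarrow> 'n mexp \<Rightarrow> real" where
  "moments B w \<alpha> = (LINT x:B|lebesgue. xpow \<alpha> x * w x)"

definition riesz :: "('n::finite mexp \<Rightarrow> real) \<Rightarrow> 'n rpoly \<Rightarrow> real" where
  "riesz y p = (\<Sum>\<alpha>\<in>Poly_Mapping.keys p. Poly_Mapping.lookup p \<alpha> * y \<alpha>)"

text \<open>
  Matrices are functions of two indices; the index set is supplied to the
  positive-semidefiniteness predicate.
\<close>
definition psd_on :: "'i set \<Rightarrow> ('i \<Rightarrow> 'i \<Rightarrow> real) \<Rightarrow> bool" where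
  "psd_on I A \<longleftrightarrow> (\<forall>i\<in>I. \<forall>j\<in>I. A i j = A j i) \<and>
     (\<forall>v :: 'i \<Rightarrow> real. 0 \<le> (\<Sum>i\<in>I. \<Sum>j\<in>I. v i * A i j * v j))"

definition moment_matrix :: "('n::finite mexp \<Rightarrow> real) \<Rightarrow> 'n mexp \<Rightarrow> 'n mexp \<Rightarrow> real" where
  "moment_matrix y \<alpha> \<beta> = y (\<alpha> + \<beta>)"

definition localizing_matrix ::
    "'n::finite rpoly \<Rightarrow> ('n mexp \<Rightarrow> real) \<Rightarrow> 'n mexp \<Rightarrow> 'n mexp \<Rightarrow> real" where
  "localizing_matrix g y \<alpha> \<beta> = riesz y (g * Poly_Mapping.single (\<alpha> + \<beta>) 1)"

text \<open>
  The unknown of the program is a family indexed by \<open>exps (2 * d)\<close> only, hence an extensional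
  function on that set.  All entries of the matrices below, and the value of the objective for
  \<open>d \<ge> half_deg f\<close>, involve only indices in this set when \<open>d \<ge> half_deg (g j)\<close>.
\<close>
definition Q_feasible ::
    "nat \<Rightarrow> (nat \<Rightarrow> 'n::finite rpoly) \<Rightarrow> ('n mexp \<Rightarrow> real) \<Rightarrow> nat \<Rightarrow> ('n mexp \<Rightarrow> real) set" where
  "Q_feasible m g y2 d = {y1 \<in> extensional (exps (2 * d)).
     psd_on (exps d) (moment_matrix y1) \<and>
     psd_on (exps d) (moment_matrix (\<lambda>\<alpha>. y2 \<alpha> - y1 \<alpha>)) \<and>
     (\<forall>j\<in>{1..m}. psd_on (exps (d - half_deg (g j))) (localizing_matrix (g j) y1))}"

definition Q_solution :: "nat \<Rightarrow> (nat \<Rightarrow> 'n::finite rpoly) \<Rightarrow> ('n mexp \<Rightarrow> real) \<Rightarrow> 'n rpoly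
    \<Rightarrow> nat \<Rightarrow> ('n mexp \<Rightarrow> real) \<Rightarrow> bool" where
  "Q_solution m g y2 f d = is_arg_max (\<lambda>y1. riesz y1 f) (\<lambda>y1. y1 \<in> Q_feasible m g y2 d)"

text \<open>The real supremum is meaningful only for a nonempty feasible set with bounded objective,
  in particular whenever \<open>Q_solution\<close> has a witness; it is then the attained maximum.\<close>
definition Q_value :: "nat \<Rightarrow> (nat \<Rightarrow> 'n::finite rpoly) \<Rightarrow> ('n mexp \<Rightarrow> real) \<Rightarrow> 'n rpoly
    \<Rightarrow> nat \<Rightarrow> real" where
  "Q_value m g y2 f d = (SUP y1\<in>Q_feasible m g y2 d. riesz y1 f)"

end

theory Submission
  imports Defs
begin

text \<open>
  The feasible set of order \<open>d\<close> is compact: the diagonal entries of \<open>M\<^sub>d(y1)\<close> lie between \<open>0\<close> and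
  those of \<open>M\<^sub>d(y2)\<close>, which are at most the mass \<open>M\<close> of \<open>\<mu>\<^sub>2\<close> because \<open>B\<close> lies in the unit box,
  and a positive semidefinite matrix is bounded by its diagonal (\<open>Q_constraints_bounded\<close>). So the
  linear objective attains its maximum. Truncating a family of higher order preserves feasibility,
  so the values decrease, and the moments of \<open>\<mu>\<^sub>2\<close> restricted to \<open>K\<close> are feasible, so the values
  stay above \<open>J\<^sup>*\<close>. All feasible families live in the compact product of the intervals \<open>[-M, M]\<close>, so
  some family \<open>y\<close> satisfies the constraints of all orders with objective at least the limit of the
  values. It remains to show \<open>L f \<le> J\<^sup>*\<close> for its functional \<open>L\<close>.

  The constraints of all orders say that \<open>L\<close>, \<open>\<integral> _ d\<mu>\<^sub>2 - L\<close> and \<open>p \<mapsto> L (g\<^sub>j p)\<close> are nonnegative on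
  squares. Then \<open>0 \<le> L (p\<^sup>2) \<le> \<integral> p\<^sup>2 d\<mu>\<^sub>2\<close>, and the Cauchy-Schwarz inequality makes \<open>L\<close> continuous
  for the supremum norm on the box (\<open>dominated_riesz_bound\<close>). A polynomial that is nonnegative on the
  box is a uniform limit of squares of polynomials, which approximate its square root. Therefore the
  three functionals are nonnegative on all polynomials nonnegative on the box
  (\<open>dominated_riesz_localized_nonneg\<close>).

  Let \<open>G\<close> be the sum of the squares of the negative parts of the \<open>g\<^sub>j\<close>; within \<open>B\<close> it vanishes
  exactly on \<open>K\<close>. The function \<open>f / (1 + k G)\<close> is \<open>f\<close> plus a combination of the \<open>g\<^sub>j\<close> with
  nonnegative continuous coefficients. Approximating the coefficients by polynomials gives
  \<open>L f \<le> \<integral> f / (1 + k G) d\<mu>\<^sub>2\<close> (\<open>dominated_riesz_le_penalized_integral\<close>), and the right-hand side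
  tends to \<open>J\<^sup>* = \<integral>\<^sub>K f d\<mu>\<^sub>2\<close> by dominated convergence as \<open>k\<close> grows.
\<close>

section \<open>Polynomials and the functional of a moment family\<close>

lemma riesz_eq_sum:
  assumes "finite A" "Poly_Mapping.keys p \<subseteq> A"
  shows "riesz y p = (\<Sum>\<alpha>\<in>A. Poly_Mapping.lookup p \<alpha> * y \<alpha>)"
  unfolding riesz_def using assms
  by (intro sum.mono_neutral_left) (auto simp: in_keys_iff)

lemma riesz_zero [simp]: "riesz y 0 = 0"
  by (simp add: riesz_def)

lemma riesz_single [simp]: "riesz y (Poly_Mapping.single \<alpha> c) = c * y \<alpha>"
  by (cases "c = 0") (auto simp: riesz_def)

lemma riesz_one [simp]: "riesz y 1 = y 0"
  by (simp flip: single_one)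

lemma riesz_add: "riesz y (p + q) = riesz y p + riesz y q"
proof -
  let ?S = "Poly_Mapping.keys p \<union> Poly_Mapping.keys q"
  have "riesz y r = (\<Sum>\<alpha>\<in>?S. Poly_Mapping.lookup r \<alpha> * y \<alpha>)"
    if "Poly_Mapping.keys r \<subseteq> ?S" for r
    using that by (intro riesz_eq_sum) auto
  then show ?thesis
    by (simp add: Poly_Mapping.keys_add lookup_add algebra_simps sum.distrib)
qed

lemma riesz_uminus: "riesz y (- p) = - riesz y p"
  using riesz_add[of y p "- p"] by simp

lemma riesz_diff: "riesz y (p - q) = riesz y p - riesz y q"
  using riesz_add[of y p "- q"] by (simp add: riesz_uminus)

lemma riesz_sum: "riesz y (sum p A) = (\<Sum>i\<in>A. riesz y (p i))"
  by (induction A rule: infinite_finite_induct) (simp_all add: riesz_add)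

lemma riesz_functional_diff: "riesz (\<lambda>\<alpha>. y \<alpha> - z \<alpha>) p = riesz y p - riesz z p"
  by (simp add: riesz_def algebra_simps sum_subtractf)

lemma riesz_cong:
  "(\<And>\<alpha>. \<alpha> \<in> Poly_Mapping.keys p \<Longrightarrow> y \<alpha> = z \<alpha>) \<Longrightarrow> riesz y p = riesz z p"
  unfolding riesz_def by (rule sum.cong) auto

lemma polynomial_eq_sum_monomials:
  assumes "finite A" "Poly_Mapping.keys p \<subseteq> A"
  shows "p = (\<Sum>\<alpha>\<in>A. Poly_Mapping.single \<alpha> (Poly_Mapping.lookup p \<alpha>))"
proof (rule poly_mapping_eqI)
  fix \<beta>
  have "Poly_Mapping.lookup (\<Sum>\<alpha>\<in>A. Poly_Mapping.single \<alpha> (Poly_Mapping.lookup p \<alpha>)) \<beta>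
      = (\<Sum>\<alpha>\<in>A. if \<alpha> = \<beta> then Poly_Mapping.lookup p \<alpha> else 0)"
    by (simp add: lookup_sum lookup_single when_def)
  also have "\<dots> = Poly_Mapping.lookup p \<beta>"
    using assms by (auto simp: in_keys_iff)
  finally show "Poly_Mapping.lookup p \<beta>
      = Poly_Mapping.lookup (\<Sum>\<alpha>\<in>A. Poly_Mapping.single \<alpha> (Poly_Mapping.lookup p \<alpha>)) \<beta>" ..
qed

lemma mult_single_eq_sum:
  "h * Poly_Mapping.single \<alpha> c
    = (\<Sum>\<beta>\<in>Poly_Mapping.keys h. Poly_Mapping.single (\<alpha> + \<beta>) (c * Poly_Mapping.lookup h \<beta>))"
  for h :: "'n::finite rpoly"
proof -
  let ?h = "\<Sum>\<beta>\<in>Poly_Mapping.keys h. Poly_Mapping.single \<beta> (Poly_Mapping.lookup h \<beta>)"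
  have "h * Poly_Mapping.single \<alpha> c = ?h * Poly_Mapping.single \<alpha> c"
    by (rule arg_cong[OF polynomial_eq_sum_monomials]) auto
  also have "\<dots> = (\<Sum>\<beta>\<in>Poly_Mapping.keys h.
      Poly_Mapping.single (\<alpha> + \<beta>) (c * Poly_Mapping.lookup h \<beta>))"
    by (simp add: sum_distrib_right mult_single add.commute[of _ \<alpha>] mult.commute[of _ c])
  finally show ?thesis .
qed

text \<open>
  The moments of \<open>h\<close> times a functional: a localizing matrix is the moment matrix of this
  family, so every statement about moment matrices also serves for localizing matrices.
\<close>
lemma riesz_localized:
  "riesz (\<lambda>\<alpha>. riesz y (h * Poly_Mapping.single \<alpha> 1)) p = riesz y (h * p)"
proof -
  let ?K = "Poly_Mapping.keys p"
  let ?p = "\<Sum>\<alpha>\<in>?K. Poly_Mapping.single \<alpha> (Poly_Mapping.lookup p \<alpha>)"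
  have scale: "riesz y (h * Poly_Mapping.single \<alpha> c) = c * riesz y (h * Poly_Mapping.single \<alpha> 1)"
    for \<alpha> c
    by (simp add: mult_single_eq_sum riesz_sum sum_distrib_left mult.assoc)
  have "riesz y (h * p) = riesz y (h * ?p)"
    by (rule arg_cong[OF polynomial_eq_sum_monomials]) auto
  also have "\<dots> = (\<Sum>\<alpha>\<in>?K. riesz y (h * Poly_Mapping.single \<alpha> (Poly_Mapping.lookup p \<alpha>)))"
    by (simp only: sum_distrib_left riesz_sum)
  also have "\<dots> = riesz (\<lambda>\<alpha>. riesz y (h * Poly_Mapping.single \<alpha> 1)) p"
    unfolding riesz_def[of _ p] by (intro sum.cong refl scale)
  finally show ?thesis ..
qed

lemma localizing_matrix_eq_moment_matrix:
  "localizing_matrix h y = moment_matrix (\<lambda>\<alpha>. riesz y (h * Poly_Mapping.single \<alpha> 1))"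
  by (intro ext) (simp add: localizing_matrix_def moment_matrix_def)

lemma quadratic_form_eq_riesz_square:
  "(\<Sum>\<alpha>\<in>I. \<Sum>\<beta>\<in>I. v \<alpha> * moment_matrix y \<alpha> \<beta> * v \<beta>)
    = riesz y ((\<Sum>\<alpha>\<in>I. Poly_Mapping.single \<alpha> (v \<alpha>)) * (\<Sum>\<alpha>\<in>I. Poly_Mapping.single \<alpha> (v \<alpha>)))"
  by (simp add: sum_product mult_single riesz_sum moment_matrix_def mult_ac)

lemma psd_on_moment_matrix:
  "psd_on I (moment_matrix y) \<longleftrightarrow>
    (\<forall>v. 0 \<le> (\<Sum>\<alpha>\<in>I. \<Sum>\<beta>\<in>I. v \<alpha> * y (\<alpha> + \<beta>) * v \<beta>))"
  by (auto simp: psd_on_def moment_matrix_def add.commute)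

lemma xpow_0 [simp]: "xpow 0 x = 1"
  by (simp add: xpow_def)

lemma xpow_add: "xpow (\<alpha> + \<beta>) x = xpow \<alpha> x * xpow \<beta> x"
  by (simp add: xpow_def lookup_add power_add prod.distrib)

text \<open>
  Evaluation at a point is the functional whose moments are the values of the monomials there.
\<close>
lemma peval_eq_riesz: "peval p x = riesz (\<lambda>\<alpha>. xpow \<alpha> x) p"
  by (simp add: peval_def riesz_def)

lemma peval_single [simp]: "peval (Poly_Mapping.single \<alpha> c) x = c * xpow \<alpha> x"
  by (simp add: peval_eq_riesz)

lemma peval_sum: "peval (sum p A) x = (\<Sum>i\<in>A. peval (p i) x)"
  by (simp add: peval_eq_riesz riesz_sum)

lemma peval_mult: "peval (p * q) x = peval p x * peval q x"
proof -
  have "peval (p * Poly_Mapping.single \<alpha> 1) x = peval p x * xpow \<alpha> x" for \<alpha>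
    by (simp add: mult_single_eq_sum peval_sum xpow_add)
      (simp add: peval_def sum_distrib_left mult_ac)
  then have "riesz (\<lambda>\<alpha>. peval (p * Poly_Mapping.single \<alpha> 1) x) q = peval p x * peval q x"
    by (simp add: peval_def riesz_def sum_distrib_left mult_ac)
  then show ?thesis
    by (simp only: peval_eq_riesz riesz_localized)
qed

lemma continuous_on_peval [continuous_intros]: "continuous_on S (peval p)"
proof -
  have "continuous_on S (\<lambda>x. \<Sum>\<alpha>\<in>Poly_Mapping.keys p. Poly_Mapping.lookup p \<alpha> * xpow \<alpha> x)"
    unfolding xpow_def by (intro continuous_intros)
  then show ?thesis
    by (simp add: peval_def[abs_def])
qed

section \<open>Degrees\<close>

lemma mdeg_add: "mdeg (\<alpha> + \<beta>) = mdeg \<alpha> + mdeg \<beta>"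
  by (simp add: mdeg_def lookup_add sum.distrib)

lemma finite_exps: "finite (exps d :: 'n::finite mexp set)"
proof (rule finite_imageD)
  have "Poly_Mapping.lookup ` (exps d :: 'n mexp set) \<subseteq> PiE UNIV (\<lambda>_. {..d})"
  proof (intro image_subsetI PiE_I)
    fix \<alpha> :: "'n mexp" and i
    assume "\<alpha> \<in> exps d"
    then show "Poly_Mapping.lookup \<alpha> i \<in> {..d}"
      unfolding exps_def mdeg_def
      using member_le_sum[of i UNIV "Poly_Mapping.lookup \<alpha>"] by simp
  qed auto
  then show "finite (Poly_Mapping.lookup ` (exps d :: 'n mexp set))"
    by (rule finite_subset) (simp add: finite_PiE)
  show "inj_on Poly_Mapping.lookup (exps d)"
    by (rule inj_onI) (simp add: lookup_inject)
qed

lemma exps_mono: "d \<le> e \<Longrightarrow> exps d \<subseteq> exps e"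
  by (auto simp: exps_def)

text \<open>
  Taking unit exponents off \<open>\<gamma>\<close> one at a time reaches every smaller degree. Hence each
  entry of a family indexed by degree at most \<open>2 * d\<close> occurs in its moment matrix of order \<open>d\<close>.
\<close>
lemma exponent_split:
  assumes "mdeg \<gamma> \<le> a + b"
  obtains \<alpha> \<beta> where "\<gamma> = \<alpha> + \<beta>" "mdeg \<alpha> \<le> a" "mdeg \<beta> \<le> b"
proof -
  have "\<exists>\<alpha> \<beta>. \<gamma> = \<alpha> + \<beta> \<and> mdeg \<alpha> \<le> a \<and> mdeg \<beta> \<le> b"
    using assms
  proof (induction a arbitrary: \<gamma>)
    case 0
    then show ?case
      by (intro exI[of _ 0] exI[of _ \<gamma>]) (simp add: mdeg_def)
  next
    case (Suc a)
    show ?case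
    proof (cases "\<gamma> = 0")
      case True
      then show ?thesis by (intro exI[of _ 0]) (simp add: mdeg_def)
    next
      case False
      then obtain i where i: "Poly_Mapping.lookup \<gamma> i \<noteq> 0"
        using poly_mapping_eqI[of \<gamma> 0] by auto
      let ?e = "Poly_Mapping.single i (1::nat)"
      have \<gamma>: "\<gamma> = ?e + (\<gamma> - ?e)"
        by (rule poly_mapping_eqI) (use i in \<open>auto simp: lookup_add lookup_minus lookup_single when_def\<close>)
      have e: "mdeg ?e = 1"
        by (simp add: mdeg_def lookup_single when_def)
      have "mdeg \<gamma> = 1 + mdeg (\<gamma> - ?e)"
        using arg_cong[OF \<gamma>, of mdeg] by (simp only: mdeg_add e)
      with Suc.prems have "mdeg (\<gamma> - ?e) \<le> a + b"
        by simp
      from Suc.IH[OF this] obtain \<alpha> \<beta>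
        where ab: "\<gamma> - ?e = \<alpha> + \<beta>" "mdeg \<alpha> \<le> a" "mdeg \<beta> \<le> b"
        by blast
      have "\<gamma> = (?e + \<alpha>) + \<beta>"
        using \<gamma> unfolding ab(1) add.assoc .
      moreover have "mdeg (?e + \<alpha>) \<le> Suc a"
        using ab(2) unfolding mdeg_add e by simp
      ultimately show ?thesis
        using ab(3) by blast
    qed
  qed
  then show thesis using that by blast
qed

lemma keys_subset_exps_iff: "Poly_Mapping.keys p \<subseteq> exps d \<longleftrightarrow> pdeg p \<le> d"
  by (auto simp: pdeg_def exps_def)

lemma pdeg_le_half_deg: "pdeg p \<le> 2 * half_deg p"
  unfolding half_deg_def by linarith

lemma keys_subset_exps:
  assumes "half_deg p \<le> d"
  shows "Poly_Mapping.keys p \<subseteq> exps (2 * d)"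
  using assms pdeg_le_half_deg[of p] by (simp add: keys_subset_exps_iff)

lemma keys_localizing_subset_exps:
  assumes "half_deg h \<le> d" "\<alpha> \<in> exps (d - half_deg h)" "\<beta> \<in> exps (d - half_deg h)"
  shows "Poly_Mapping.keys (h * Poly_Mapping.single (\<alpha> + \<beta>) 1) \<subseteq> exps (2 * d)"
proof
  fix \<gamma> assume "\<gamma> \<in> Poly_Mapping.keys (h * Poly_Mapping.single (\<alpha> + \<beta>) (1::real))"
  with Poly_Mapping.keys_mult[of h "Poly_Mapping.single (\<alpha> + \<beta>) (1::real)"]
  obtain \<delta> where "\<delta> \<in> Poly_Mapping.keys h" "\<gamma> = \<delta> + (\<alpha> + \<beta>)"
    by auto
  moreover from this have "mdeg \<delta> \<le> 2 * half_deg h"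
    using keys_subset_exps[of h "half_deg h"] by (auto simp: exps_def)
  ultimately show "\<gamma> \<in> exps (2 * d)"
    using assms by (simp add: exps_def mdeg_add)
qed

section \<open>Positive semidefinite forms\<close>

lemma psd_onD:
  "psd_on I A \<Longrightarrow> 0 \<le> (\<Sum>i\<in>I. \<Sum>j\<in>I. v i * A i j * v j)"
  unfolding psd_on_def by blast

lemma psd_on_subset:
  assumes "psd_on J A" "I \<subseteq> J" "finite J"
  shows "psd_on I A"
proof -
  have "0 \<le> (\<Sum>i\<in>I. \<Sum>j\<in>I. v i * A i j * v j)" for v
  proof -
    let ?v = "\<lambda>i. if i \<in> I then v i else 0"
    have "(\<Sum>i\<in>J. \<Sum>j\<in>J. ?v i * A i j * ?v j) = (\<Sum>i\<in>I. \<Sum>j\<in>J. ?v i * A i j * ?v j)"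
      using assms by (intro sum.mono_neutral_right) auto
    also have "\<dots> = (\<Sum>i\<in>I. \<Sum>j\<in>I. v i * A i j * v j)"
      using assms by (intro sum.cong[OF refl] sum.mono_neutral_cong_right) auto
    finally show ?thesis
      using psd_onD[OF assms(1), of ?v] by simp
  qed
  moreover have "\<forall>i\<in>I. \<forall>j\<in>I. A i j = A j i"
    using assms unfolding psd_on_def by blast
  ultimately show ?thesis
    unfolding psd_on_def by blast
qed

lemma psd_on_diagonal_nonneg:
  assumes "psd_on I A" "i \<in> I" "finite I"
  shows "0 \<le> A i i"
proof -
  have "psd_on {i} A"
    using assms by (intro psd_on_subset[OF assms(1)]) auto
  from psd_onD[OF this, of "\<lambda>_. 1"] show ?thesis by simp
qed

text \<open>
  Test the form restricted to two indices on \<open>(1, 1)\<close> and \<open>(1, -1)\<close>.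
\<close>
lemma psd_on_offdiagonal_bound:
  assumes "psd_on I A" "i \<in> I" "j \<in> I" "finite I" "A i i \<le> c" "A j j \<le> c"
  shows "\<bar>A i j\<bar> \<le> c"
proof (cases "i = j")
  case True
  then show ?thesis
    using psd_on_diagonal_nonneg[OF assms(1,2,4)] assms by simp
next
  case False
  have ij: "psd_on {i, j} A"
    using assms by (intro psd_on_subset[OF assms(1)]) auto
  then have sym: "A j i = A i j"
    unfolding psd_on_def by blast
  from psd_onD[OF ij, of "\<lambda>_. 1"] psd_onD[OF ij, of "\<lambda>k. if k = i then 1 else -1"] show ?thesis
    using False sym assms(5,6) by auto
qed

lemma psd_on_moment_matrix_iff_riesz_square:
  fixes y :: "'n::finite mexp \<Rightarrow> real"
  shows "(\<forall>d. psd_on (exps d) (moment_matrix y)) \<longleftrightarrow> (\<forall>p. 0 \<le> riesz y (p * p))"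
proof
  assume psd: "\<forall>d. psd_on (exps d) (moment_matrix y)"
  show "\<forall>p. 0 \<le> riesz y (p * p)"
  proof
    fix p :: "'n rpoly"
    have p: "p = (\<Sum>\<alpha>\<in>exps (pdeg p). Poly_Mapping.single \<alpha> (Poly_Mapping.lookup p \<alpha>))"
      using keys_subset_exps_iff[of p "pdeg p"]
      by (intro polynomial_eq_sum_monomials finite_exps) simp
    have "riesz y (p * p) = (\<Sum>\<alpha>\<in>exps (pdeg p). \<Sum>\<beta>\<in>exps (pdeg p).
        Poly_Mapping.lookup p \<alpha> * moment_matrix y \<alpha> \<beta> * Poly_Mapping.lookup p \<beta>)"
      unfolding quadratic_form_eq_riesz_square
      by (rule arg_cong[OF p, of "\<lambda>r. riesz y (r * r)"])
    also have "\<dots> \<ge> 0"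
      using psd by (intro psd_onD) blast
    finally show "0 \<le> riesz y (p * p)" .
  qed
next
  assume "\<forall>p. 0 \<le> riesz y (p * p)"
  then show "\<forall>d. psd_on (exps d) (moment_matrix y)"
    by (simp add: psd_on_moment_matrix quadratic_form_eq_riesz_square[unfolded moment_matrix_def])
qed

text \<open>
  Polynomials form an algebra that contains the coordinates, which separate points.
\<close>
section \<open>Positivity from squares and uniform approximation\<close>

lemma polynomial_approximation:
  fixes S :: "(real^'n::finite) set" and F :: "real^'n \<Rightarrow> real"
  assumes "compact S" "continuous_on S F" "0 < e"
  obtains p where "\<And>x. x \<in> S \<Longrightarrow> \<bar>F x - peval p x\<bar> < e"
proof -
  have "\<exists>h. (\<exists>p :: 'n rpoly. h = peval p) \<and> (\<forall>x\<in>S. \<bar>F x - h x\<bar> < e)"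
  proof (rule Stone_Weierstrass_HOL[OF assms(1) _ _ _ _ _ assms(2,3)])
    show "\<exists>p :: 'n rpoly. (\<lambda>x. c) = peval p" for c
      by (intro exI[of _ "Poly_Mapping.single 0 c"]) auto
    show "continuous_on S h" if "\<exists>p :: 'n rpoly. h = peval p" for h
      using that by (auto intro: continuous_on_peval)
    show "\<exists>p :: 'n rpoly. (\<lambda>x. h x + k x) = peval p"
      if "(\<exists>p :: 'n rpoly. h = peval p) \<and> (\<exists>p :: 'n rpoly. k = peval p)" for h k
      using that by (auto simp flip: peval_add)
    show "\<exists>p :: 'n rpoly. (\<lambda>x. h x * k x) = peval p"
      if "(\<exists>p :: 'n rpoly. h = peval p) \<and> (\<exists>p :: 'n rpoly. k = peval p)" for h k
      using that by (auto simp flip: peval_mult)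
    show "\<exists>h. (\<exists>p :: 'n rpoly. h = peval p) \<and> h x \<noteq> h y"
      if "x \<in> S \<and> y \<in> S \<and> x \<noteq> y" for x y
    proof -
      from that obtain i where "x $ i \<noteq> y $ i"
        by (metis vec_eq_iff)
      moreover have "peval (Poly_Mapping.single (Poly_Mapping.single i 1) 1) z = z $ i"
        for z :: "real^'n"
      proof -
        have "xpow (Poly_Mapping.single i 1) z = (\<Prod>k\<in>UNIV. if k = i then z $ k else 1)"
          unfolding xpow_def by (rule prod.cong) (auto simp: lookup_single when_def)
        then show ?thesis by simp
      qed
      ultimately show ?thesis
        by (intro exI[of _ "peval (Poly_Mapping.single (Poly_Mapping.single i 1) 1)"]) auto
    qed
  qed
  then show thesis using that by blast
qed

lemma compact_imp_abs_bounded: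
  assumes "compact S" "continuous_on S F"
  obtains R :: real where "0 < R" "\<And>x. x \<in> S \<Longrightarrow> \<bar>F x\<bar> \<le> R"
  using compact_imp_bounded[OF compact_continuous_image[OF assms(2,1)]]
  by (auto simp: bounded_pos)

text \<open>
  A polynomial nonnegative on \<open>S\<close> need not be a sum of squares, but its square root is continuous there, so it is uniformly close to the square
  of a polynomial; a functional that is continuous for the supremum norm on \<open>S\<close> cannot tell the
  difference.
\<close>
lemma riesz_nonneg_of_squares:
  assumes S: "compact S"
    and sq: "\<And>q. 0 \<le> riesz y (q * q)"
    and bound: "\<And>q s. 0 < s \<Longrightarrow> (\<And>x. x \<in> S \<Longrightarrow> \<bar>peval q x\<bar> \<le> s) \<Longrightarrow> \<bar>riesz y q\<bar> \<le> C * s"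
    and nonneg: "\<And>x. x \<in> S \<Longrightarrow> 0 \<le> peval p x"
  shows "0 \<le> riesz y p"
proof (rule field_le_epsilon)
  fix e :: real assume e: "0 < e"
  have C: "0 \<le> C"
    using bound[of 1 0] by (simp add: peval_eq_riesz)
  have cont: "continuous_on S (\<lambda>x. sqrt (peval p x))"
    by (intro continuous_intros)
  obtain R where R: "0 < R" "\<And>x. x \<in> S \<Longrightarrow> \<bar>sqrt (peval p x)\<bar> \<le> R"
    using compact_imp_abs_bounded[OF S cont] by blast
  define \<delta> where "\<delta> = min 1 (e / ((C + 1) * (2 * R + 1)))"
  have D: "0 < (C + 1) * (2 * R + 1)"
    using C R(1) by simp
  have \<delta>: "0 < \<delta>" "\<delta> \<le> 1"
    using D e by (auto simp: \<delta>_def)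
  have "\<delta> \<le> e / ((C + 1) * (2 * R + 1))"
    by (simp add: \<delta>_def)
  then have \<delta>e: "(C + 1) * (\<delta> * (2 * R + 1)) \<le> e"
    unfolding pos_le_divide_eq[OF D] by (simp only: mult.left_commute)
  obtain q where q: "\<And>x. x \<in> S \<Longrightarrow> \<bar>sqrt (peval p x) - peval q x\<bar> < \<delta>"
    using polynomial_approximation[OF S cont \<delta>(1)] by blast
  have "\<bar>peval (q * q - p) x\<bar> \<le> \<delta> * (2 * R + 1)" if x: "x \<in> S" for x
  proof -
    let ?r = "sqrt (peval p x)"
    have "\<bar>peval (q * q - p) x\<bar> = \<bar>?r - peval q x\<bar> * \<bar>?r + peval q x\<bar>"
      using nonneg[OF x] by (simp add: peval_diff peval_mult flip: abs_mult) (simp add: algebra_simps)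
    also have "\<dots> \<le> \<delta> * (2 * R + 1)"
      using q[OF x] R(2)[OF x] \<delta> by (intro mult_mono) auto
    finally show ?thesis .
  qed
  then have "\<bar>riesz y (q * q - p)\<bar> \<le> C * (\<delta> * (2 * R + 1))"
    using \<delta> R(1) by (intro bound) auto
  also have "\<dots> \<le> (C + 1) * (\<delta> * (2 * R + 1))"
    using \<delta> R(1) by (intro mult_right_mono) auto
  finally show "0 \<le> riesz y p + e"
    using sq[of q] \<delta>e by (simp add: riesz_diff)
qed

text \<open>
  The Cauchy-Schwarz inequality for the form \<open>(p, q) \<mapsto> L (p q)\<close> against the constant \<open>s\<close>, that is,
  \<open>L ((s + p)\<^sup>2) \<ge> 0\<close> and \<open>L ((s - p)\<^sup>2) \<ge> 0\<close>.
\<close>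
lemma riesz_bound_of_square_bound:
  assumes sq: "\<And>q. 0 \<le> riesz y (q * q)"
    and "y 0 \<le> c" "riesz y (p * p) \<le> c * s\<^sup>2" "0 < s"
  shows "\<bar>riesz y p\<bar> \<le> c * s"
proof -
  let ?s = "Poly_Mapping.single 0 s"
  have sp: "riesz y (?s * p) = s * riesz y p"
    using riesz_localized[of y p ?s] by (simp add: mult.commute)
  have "(a + b) * (a + b) = a * a + a * b + a * b + b * b"
    and "(a - b) * (a - b) = a * a - a * b - a * b + b * b" for a b :: "'a rpoly"
    by (simp_all add: algebra_simps)
  note expand = this
  have "riesz y ((?s + p) * (?s + p)) = s\<^sup>2 * y 0 + 2 * s * riesz y p + riesz y (p * p)"
    unfolding expand riesz_add sp by (simp add: mult_single power2_eq_square)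
  moreover have "riesz y ((?s - p) * (?s - p)) = s\<^sup>2 * y 0 - 2 * s * riesz y p + riesz y (p * p)"
    unfolding expand riesz_add riesz_diff sp by (simp add: mult_single power2_eq_square)
  ultimately have "2 * s * \<bar>riesz y p\<bar> \<le> s\<^sup>2 * y 0 + riesz y (p * p)"
    using sq[of "?s + p"] sq[of "?s - p"] by (simp add: abs_if)
  also have "\<dots> \<le> s\<^sup>2 * c + c * s\<^sup>2"
    using assms by (intro add_mono mult_left_mono) auto
  also have "\<dots> = 2 * s * (c * s)"
    by (simp add: power2_eq_square)
  finally show ?thesis
    using \<open>0 < s\<close> by simp
qed

lemma
  assumes "S \<in> sets lebesgue" "S \<subseteq> B"
    and "\<And>\<alpha>. set_integrable lebesgue B (\<lambda>x. xpow \<alpha> x * w x)"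
  shows set_integrable_peval: "set_integrable lebesgue S (\<lambda>x. peval p x * w x)"
    and riesz_moments: "riesz (moments S w) p = (LINT x:S|lebesgue. peval p x * w x)"
proof -
  have mono: "set_integrable lebesgue S (\<lambda>x. xpow \<alpha> x * w x)" for \<alpha>
    using assms by (blast intro: set_integrable_subset)
  have eq: "indicat_real S x *\<^sub>R (peval p x * w x)
      = (\<Sum>\<alpha>\<in>Poly_Mapping.keys p. Poly_Mapping.lookup p \<alpha> * (indicat_real S x *\<^sub>R (xpow \<alpha> x * w x)))" for x
    by (simp add: peval_def sum_distrib_left sum_distrib_right mult_ac)
  show "set_integrable lebesgue S (\<lambda>x. peval p x * w x)"
    unfolding set_integrable_def eq
    by (intro Bochner_Integration.integrable_sum integrable_mult_right mono[unfolded set_integrable_def])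
  show "riesz (moments S w) p = (LINT x:S|lebesgue. peval p x * w x)"
    unfolding set_lebesgue_integral_def eq riesz_def moments_def
    using mono[unfolded set_integrable_def]
    by (subst Bochner_Integration.integral_sum) auto
qed

section \<open>Functionals dominated by a weighted measure\<close>

lemma riesz_moments_square_bound:
  assumes B: "B \<in> sets lebesgue" "B \<subseteq> S"
    and int: "\<And>\<alpha>. set_integrable lebesgue B (\<lambda>x. xpow \<alpha> x * w x)"
    and w: "\<And>x. 0 \<le> w x"
    and p: "\<And>x. x \<in> S \<Longrightarrow> \<bar>peval p x\<bar> \<le> s"
  shows "riesz (moments B w) (p * p) \<le> moments B w 0 * s\<^sup>2"
proof -
  have "riesz (moments B w) (p * p) = (LINT x:B|lebesgue. peval (p * p) x * w x)"
    by (rule riesz_moments[OF B(1) subset_refl int])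
  also have "\<dots> \<le> (LINT x:B|lebesgue. s\<^sup>2 * w x)"
  proof (rule set_integral_mono)
    show "set_integrable lebesgue B (\<lambda>x. peval (p * p) x * w x)"
      by (rule set_integrable_peval[OF B(1) subset_refl int])
    show "set_integrable lebesgue B (\<lambda>x. s\<^sup>2 * w x)"
      using int[of 0] by simp
    show "peval (p * p) x * w x \<le> s\<^sup>2 * w x" if "x \<in> B" for x
    proof (rule mult_right_mono[OF _ w])
      have "\<bar>peval p x\<bar>\<^sup>2 \<le> s\<^sup>2"
        using p that B(2) by (intro power_mono) auto
      then show "peval (p * p) x \<le> s\<^sup>2"
        by (simp add: peval_mult power2_eq_square)
    qed
  qed
  also have "\<dots> = moments B w 0 * s\<^sup>2"
    by (simp add: moments_def)
  finally show ?thesis .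
qed

text \<open>
  Domination by the measure on squares makes the functional continuous for the supremum norm.
\<close>
lemma dominated_riesz_bound:
  assumes B: "B \<in> sets lebesgue" "B \<subseteq> S"
    and int: "\<And>\<alpha>. set_integrable lebesgue B (\<lambda>x. xpow \<alpha> x * w x)"
    and w: "\<And>x. 0 \<le> w x"
    and sq: "\<And>q. 0 \<le> riesz y (q * q)"
    and dom: "\<And>q. riesz y (q * q) \<le> riesz (moments B w) (q * q)"
    and s: "0 < s" "\<And>x. x \<in> S \<Longrightarrow> \<bar>peval p x\<bar> \<le> s"
  shows "\<bar>riesz y p\<bar> \<le> moments B w 0 * s"
proof (rule riesz_bound_of_square_bound[OF sq _ _ s(1)])
  show "y 0 \<le> moments B w 0"
    using dom[of 1] by simp
  show "riesz y (p * p) \<le> moments B w 0 * s\<^sup>2"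
    using dom[of p] riesz_moments_square_bound[OF B int w s(2)] by linarith
qed

text \<open>
  The product with \<open>h\<close> is bounded in the supremum norm on \<open>S\<close>, so localization at \<open>h\<close>
  preserves the continuity that the approximation by squares requires.
\<close>
lemma dominated_riesz_localized_nonneg:
  assumes B: "B \<in> sets lebesgue" "B \<subseteq> S"
    and int: "\<And>\<alpha>. set_integrable lebesgue B (\<lambda>x. xpow \<alpha> x * w x)"
    and w: "\<And>x. 0 \<le> w x"
    and sq: "\<And>q. 0 \<le> riesz y (q * q)"
    and dom: "\<And>q. riesz y (q * q) \<le> riesz (moments B w) (q * q)"
    and S: "compact S"
    and loc: "\<And>q. 0 \<le> riesz y (h * (q * q))"
    and p: "\<And>x. x \<in> S \<Longrightarrow> 0 \<le> peval p x"
  shows "0 \<le> riesz y (h * p)"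
proof -
  let ?z = "\<lambda>\<alpha>. riesz y (h * Poly_Mapping.single \<alpha> 1)"
  obtain R where R: "0 < R" "\<And>x. x \<in> S \<Longrightarrow> \<bar>peval h x\<bar> \<le> R"
    using compact_imp_abs_bounded[OF S continuous_on_peval] by blast
  have "0 \<le> riesz ?z p"
  proof (rule riesz_nonneg_of_squares[OF S _ _ p])
    show "0 \<le> riesz ?z (q * q)" for q
      by (simp only: riesz_localized loc)
    show "\<bar>riesz ?z q\<bar> \<le> (moments B w 0 * R) * s"
      if s: "0 < s" "\<And>x. x \<in> S \<Longrightarrow> \<bar>peval q x\<bar> \<le> s" for q s
    proof -
      have "\<bar>riesz y (h * q)\<bar> \<le> moments B w 0 * (R * s)"
        using R s by (intro dominated_riesz_bound[OF B int w sq dom])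
          (auto simp: peval_mult abs_mult intro!: mult_mono)
      then show ?thesis
        by (simp only: riesz_localized mult.assoc)
    qed
  qed
  then show ?thesis
    by (simp only: riesz_localized)
qed

text \<open>
  The weights \<open>1 / (1 + k G)\<close> decrease to the indicator of the zero set of \<open>G\<close>.
\<close>
lemma penalized_integral_tendsto:
  fixes f G w :: "real^'n::finite \<Rightarrow> real"
  assumes B: "B \<in> sets lebesgue" and K: "K \<in> sets lebesgue" "K \<subseteq> B"
    and int: "set_integrable lebesgue B (\<lambda>x. f x * w x)"
    and wm: "w \<in> borel_measurable lebesgue"
    and f: "continuous_on UNIV f" and G: "continuous_on UNIV G"
    and G_nonneg: "\<And>x. 0 \<le> G x"
    and G_zero: "\<And>x. x \<in> B \<Longrightarrow> G x = 0 \<longleftrightarrow> x \<in> K"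
  shows "set_integrable lebesgue B (\<lambda>x. f x / (1 + real k * G x) * w x)"
    and "(\<lambda>k. LINT x:B|lebesgue. f x / (1 + real k * G x) * w x)
      \<longlonglongrightarrow> (LINT x:K|lebesgue. f x * w x)"
proof -
  have pos: "1 \<le> 1 + real k * G x" for k x
    using G_nonneg[of x] by simp
  have meas: "(\<lambda>x. f x / (1 + real k * G x) * w x) \<in> borel_measurable lebesgue" for k
  proof -
    have "continuous_on UNIV (\<lambda>x. f x / (1 + real k * G x))"
      using pos by (intro continuous_intros f G) (metis not_one_le_zero)
    then have "(\<lambda>x. f x / (1 + real k * G x)) \<in> borel_measurable lebesgue"
      by (intro measurable_completion) (simp add: borel_measurable_continuous_onI)
    then show ?thesis
      using wm by (rule borel_measurable_times)
  qed
  have bound: "\<bar>f x / (1 + real k * G x) * w x\<bar> \<le> \<bar>f x * w x\<bar>" for k x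
  proof -
    have "\<bar>f x\<bar> / (1 + real k * G x) \<le> \<bar>f x\<bar> / 1"
      using pos[of k x] by (intro divide_left_mono) auto
    then have "\<bar>f x / (1 + real k * G x)\<bar> \<le> \<bar>f x\<bar>"
      using pos[of k x] by (simp add: abs_divide)
    then show ?thesis
      unfolding abs_mult[of _ "w x"] by (rule mult_right_mono) simp
  qed
  have int_k: "set_integrable lebesgue B (\<lambda>x. f x / (1 + real k * G x) * w x)" for k
  proof (rule set_integrable_bound[OF int])
    show "set_borel_measurable lebesgue B (\<lambda>x. f x / (1 + real k * G x) * w x)"
      unfolding set_borel_measurable_def by (intro borel_measurable_scaleR borel_measurable_indicator B meas)
  qed (use bound in simp)
  then show "set_integrable lebesgue B (\<lambda>x. f x / (1 + real k * G x) * w x)" .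
  have KB: "(LINT x:K|lebesgue. f x * w x)
      = (\<integral>x. indicat_real B x *\<^sub>R (indicat_real K x *\<^sub>R (f x * w x)) \<partial>lebesgue)"
    unfolding set_lebesgue_integral_def using K(2)
    by (intro Bochner_Integration.integral_cong) (auto simp: indicator_def)
  show "(\<lambda>k. LINT x:B|lebesgue. f x / (1 + real k * G x) * w x)
      \<longlonglongrightarrow> (LINT x:K|lebesgue. f x * w x)"
    unfolding KB unfolding set_lebesgue_integral_def
  proof (rule integral_dominated_convergence)
    show "integrable lebesgue (\<lambda>x. \<bar>indicat_real B x *\<^sub>R (f x * w x)\<bar>)"
      using int unfolding set_integrable_def by (rule integrable_abs)
    show "(\<lambda>x. indicat_real B x *\<^sub>R (f x / (1 + real k * G x) * w x)) \<in> borel_measurable lebesgue" for k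
      using int_k[of k] unfolding set_integrable_def by (rule borel_measurable_integrable)
    show "(\<lambda>x. indicat_real B x *\<^sub>R (indicat_real K x *\<^sub>R (f x * w x))) \<in> borel_measurable lebesgue"
    proof -
      have "(\<lambda>x. f x * w x) \<in> borel_measurable lebesgue"
        using meas[of 0] by simp
      then show ?thesis
        using B K by simp
    qed
    show "AE x in lebesgue. norm (indicat_real B x *\<^sub>R (f x / (1 + real k * G x) * w x))
        \<le> \<bar>indicat_real B x *\<^sub>R (f x * w x)\<bar>" for k
      using bound[of _ k] by (intro AE_I2) (auto simp: indicator_def)
    show "AE x in lebesgue. (\<lambda>k. indicat_real B x *\<^sub>R (f x / (1 + real k * G x) * w x))
        \<longlonglongrightarrow> indicat_real B x *\<^sub>R (indicat_real K x *\<^sub>R (f x * w x))"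
    proof (rule AE_I2)
      fix x
      consider "x \<notin> B" | "x \<in> K" | "x \<in> B" "x \<notin> K" by blast
      then show "(\<lambda>k. indicat_real B x *\<^sub>R (f x / (1 + real k * G x) * w x))
        \<longlonglongrightarrow> indicat_real B x *\<^sub>R (indicat_real K x *\<^sub>R (f x * w x))"
      proof cases
        case 1 then show ?thesis by simp
      next
        case 2
        then have "x \<in> B" "G x = 0"
          using K(2) G_zero[of x] by auto
        with 2 show ?thesis by simp
      next
        case 3
        then have "0 < G x"
          using G_zero[of x] G_nonneg[of x] by simp
        then have "filterlim (\<lambda>k. 1 + real k * G x) at_top sequentially"
          by (intro filterlim_tendsto_add_at_top[OF tendsto_const]
              filterlim_at_top_mult_tendsto_pos[OF tendsto_const _ filterlim_real_sequentially])
        then have "(\<lambda>k. f x / (1 + real k * G x)) \<longlonglongrightarrow> 0"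
          by (intro real_tendsto_divide_at_top[OF tendsto_const])
        then show ?thesis
          using 3 tendsto_mult_left_zero[of "\<lambda>k. f x / (1 + real k * G x)" sequentially "w x"] by simp
      qed
    qed
  qed
qed

text \<open>
  Write \<open>g\<^sub>j\<^sup>-\<close> for \<open>max 0 (- g\<^sub>j)\<close>, so that \<open>G\<close> is the sum of the squares of the \<open>g\<^sub>j\<^sup>-\<close>.
  Because \<open>g\<^sub>j g\<^sub>j\<^sup>- = - (g\<^sub>j\<^sup>-)\<^sup>2\<close>, the penalized integrand is
  \<open>F = f + (\<Sum>j. g\<^sub>j u\<^sub>j)\<close> with \<open>u\<^sub>j = k f g\<^sub>j\<^sup>- / (1 + k G) \<ge> 0\<close>. Adding \<open>g\<^sub>j\<close> times a
  nonnegative function can only increase the functional, and the functional is at most the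
  measure; formally \<open>L f \<le> L F \<le> \<integral> F\<close>. Polynomials slightly above the \<open>u\<^sub>j\<close> make this rigorous.
\<close>
lemma dominated_riesz_le_penalized_integral:
  fixes g :: "nat \<Rightarrow> 'n::finite rpoly" and f :: "'n rpoly" and w :: "real^'n \<Rightarrow> real"
    and m k :: nat
  defines "G \<equiv> \<lambda>x. \<Sum>j=1..m. (max 0 (- peval (g j) x))\<^sup>2"
  defines "F \<equiv> \<lambda>x. peval f x / (1 + real k * G x)"
  assumes B: "B \<in> sets lebesgue" "B \<subseteq> S"
    and int: "\<And>\<alpha>. set_integrable lebesgue B (\<lambda>x. xpow \<alpha> x * w x)"
    and w: "\<And>x. 0 \<le> w x"
    and sq: "\<And>q. 0 \<le> riesz y (q * q)"
    and dom: "\<And>q. riesz y (q * q) \<le> riesz (moments B w) (q * q)"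
    and S: "compact S"
    and loc: "\<And>j q. j \<in> {1..m} \<Longrightarrow> 0 \<le> riesz y (g j * (q * q))"
    and f: "\<And>x. x \<in> S \<Longrightarrow> 0 \<le> peval f x"
    and F_int: "set_integrable lebesgue B (\<lambda>x. F x * w x)"
  shows "riesz y f \<le> (LINT x:B|lebesgue. F x * w x)"
proof (rule field_le_epsilon)
  fix e :: real assume e: "0 < e"
  let ?M = "moments B w 0"
  have y0: "0 \<le> y 0" "y 0 \<le> ?M"
    using sq[of 1] dom[of 1] by simp_all
  have G_nonneg: "0 \<le> G x" for x
    by (simp add: G_def sum_nonneg)
  have pos: "1 \<le> 1 + real k * G x" for x
    using G_nonneg[of x] by simp
  define u where "u j x = peval f x * real k * max 0 (- peval (g j) x) / (1 + real k * G x)" for j x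
  have u_nonneg: "0 \<le> u j x" if "x \<in> S" for j x
    using f[OF that] pos[of x] by (auto simp: u_def intro!: divide_nonneg_nonneg mult_nonneg_nonneg)
  have u_cont: "continuous_on S (u j)" for j
  proof -
    have "1 + real k * (\<Sum>j=1..m. (max 0 (- peval (g j) x))\<^sup>2) \<noteq> 0" for x
      using pos[of x] unfolding G_def by linarith
    then show ?thesis
      unfolding u_def G_def by (intro continuous_intros) auto
  qed
  have F_eq: "peval f x + (\<Sum>j=1..m. peval (g j) x * u j x) = F x" for x
  proof -
    have sq_neg: "t * max 0 (- t) = - (max 0 (- t))\<^sup>2" for t :: real
      by (simp add: max_def power2_eq_square)
    have "peval (g j) x * u j x
        = - (peval f x * real k / (1 + real k * G x)) * (max 0 (- peval (g j) x))\<^sup>2" for j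
    proof -
      have "peval (g j) x * u j x = (peval f x * real k / (1 + real k * G x))
          * (peval (g j) x * max 0 (- peval (g j) x))"
        by (simp add: u_def)
      then show ?thesis
        unfolding sq_neg by simp
    qed
    then have "(\<Sum>j=1..m. peval (g j) x * u j x) = - (peval f x * real k / (1 + real k * G x)) * G x"
      by (simp only: sum_distrib_left[symmetric] G_def)
    moreover have "1 + real k * G x \<noteq> 0"
      using pos[of x] by linarith
    ultimately show ?thesis
      unfolding F_def by (simp add: field_simps)
  qed
  have cont_sum: "continuous_on S (\<lambda>x. \<Sum>j=1..m. \<bar>peval (g j) x\<bar>)"
    by (intro continuous_intros)
  obtain C where C: "0 < C" "\<And>x. x \<in> S \<Longrightarrow> (\<Sum>j=1..m. \<bar>peval (g j) x\<bar>) \<le> C"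
    using compact_imp_abs_bounded[OF S cont_sum] by (metis abs_le_D1)
  \<comment> \<open>Both the error in \<open>q\<close> and the shift that keeps \<open>q\<close> nonnegative cost \<open>C * \<eta>\<close>
    per unit mass; the \<open>1\<close> added to the mass keeps the denominator positive.\<close>
  define \<eta> where "\<eta> = e / (2 * C * (?M + 1))"
  have \<eta>: "0 < \<eta>"
    using e C(1) y0 by (simp add: \<eta>_def)
  \<comment> \<open>Aiming at \<open>u j + \<eta> / 2\<close> keeps the approximation above \<open>u j\<close>, hence nonnegative on \<open>S\<close>.\<close>
  have "\<exists>p. \<forall>x\<in>S. \<bar>(u j x + \<eta> / 2) - peval p x\<bar> < \<eta> / 2" for j
    using polynomial_approximation[OF S continuous_on_add[OF u_cont continuous_on_const], of "\<eta> / 2" j] \<eta>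
    by (metis half_gt_zero)
  then obtain p where p: "\<And>j x. x \<in> S \<Longrightarrow> \<bar>(u j x + \<eta> / 2) - peval (p j) x\<bar> < \<eta> / 2"
    by metis
  define q where "q = f + (\<Sum>j=1..m. g j * p j) + Poly_Mapping.single 0 (C * \<eta>)"
  have q_eval: "peval q x = F x + (\<Sum>j=1..m. peval (g j) x * (peval (p j) x - u j x)) + C * \<eta>" for x
    unfolding q_def F_eq[symmetric]
    by (simp add: peval_add peval_sum peval_mult right_diff_distrib sum_subtractf)
  have err: "\<bar>\<Sum>j=1..m. peval (g j) x * (peval (p j) x - u j x)\<bar> \<le> C * \<eta>" if x: "x \<in> S" for x
  proof -
    have "\<bar>\<Sum>j=1..m. peval (g j) x * (peval (p j) x - u j x)\<bar>
        \<le> (\<Sum>j=1..m. \<bar>peval (g j) x * (peval (p j) x - u j x)\<bar>)"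
      by (rule sum_abs)
    also have "\<dots> \<le> (\<Sum>j=1..m. \<bar>peval (g j) x\<bar> * \<eta>)"
    proof (rule sum_mono)
      fix j
      have "\<bar>peval (p j) x - u j x\<bar> \<le> \<eta>"
        using p[OF x, of j] by linarith
      then show "\<bar>peval (g j) x * (peval (p j) x - u j x)\<bar> \<le> \<bar>peval (g j) x\<bar> * \<eta>"
        by (simp add: abs_mult mult_left_mono)
    qed
    also have "\<dots> \<le> C * \<eta>"
      using C(2)[OF x] \<eta> by (simp flip: sum_distrib_right)
    finally show ?thesis .
  qed
  have F_nonneg: "0 \<le> F x" if "x \<in> S" for x
    unfolding F_def using f[OF that] pos[of x] by (intro divide_nonneg_nonneg) linarith+
  have q_nonneg: "0 \<le> peval q x" if "x \<in> S" for x
    using F_nonneg[OF that] err[OF that] unfolding q_eval by linarith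
  have q_le: "peval q x \<le> F x + 2 * C * \<eta>" if "x \<in> S" for x
    using err[OF that] unfolding q_eval by linarith
  have p_nonneg: "0 \<le> peval (p j) x" if "x \<in> S" for j x
    using p[OF that, of j] u_nonneg[OF that, of j] by linarith
  have "riesz y f \<le> riesz y q"
  proof -
    have "0 \<le> riesz y (g j * p j)" if "j \<in> {1..m}" for j
      by (rule dominated_riesz_localized_nonneg[OF B int w sq dom S loc[OF that] p_nonneg])
    then have "0 \<le> riesz y (\<Sum>j=1..m. g j * p j)"
      unfolding riesz_sum by (rule sum_nonneg)
    then show ?thesis
      using C(1) \<eta> y0(1) by (simp add: q_def riesz_add)
  qed
  also have "riesz y q \<le> riesz (moments B w) q"
  proof -
    let ?z = "\<lambda>\<alpha>. moments B w \<alpha> - y \<alpha>"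
    have "0 \<le> riesz ?z (1 * q)"
      using sq dom by (intro dominated_riesz_localized_nonneg[OF B int w _ _ S _ q_nonneg])
        (simp_all add: riesz_functional_diff)
    then show ?thesis
      by (simp add: riesz_functional_diff)
  qed
  also have "riesz (moments B w) q = (LINT x:B|lebesgue. peval q x * w x)"
    by (rule riesz_moments[OF B(1) subset_refl int])
  also have "\<dots> \<le> (LINT x:B|lebesgue. F x * w x + 2 * C * \<eta> * w x)"
  proof (rule set_integral_mono)
    show "set_integrable lebesgue B (\<lambda>x. peval q x * w x)"
      by (rule set_integrable_peval[OF B(1) subset_refl int])
    show "set_integrable lebesgue B (\<lambda>x. F x * w x + 2 * C * \<eta> * w x)"
      using int[of 0] by (intro set_integral_add F_int) simp
    show "peval q x * w x \<le> F x * w x + 2 * C * \<eta> * w x" if "x \<in> B" for x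
      using mult_right_mono[OF q_le w, of x] that B(2) by (auto simp: distrib_right)
  qed
  also have "\<dots> = (LINT x:B|lebesgue. F x * w x) + 2 * C * \<eta> * ?M"
    using int[of 0] by (subst set_integral_add[OF F_int]) (simp_all add: moments_def)
  also have "\<dots> \<le> (LINT x:B|lebesgue. F x * w x) + e"
  proof -
    have "2 * C * \<eta> * ?M \<le> 2 * C * \<eta> * (?M + 1)"
      using C(1) \<eta> by (intro mult_left_mono) auto
    also have "\<dots> = e"
      using C(1) y0 by (simp add: \<eta>_def)
    finally show ?thesis by simp
  qed
  finally show "riesz y f \<le> (LINT x:B|lebesgue. F x * w x) + e" .
qed

lemma dominated_riesz_le_integral_semialg:
  fixes g :: "nat \<Rightarrow> 'n::finite rpoly" and w :: "real^'n \<Rightarrow> real"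
  assumes B: "B \<in> sets lebesgue" "B \<subseteq> S"
    and int: "\<And>\<alpha>. set_integrable lebesgue B (\<lambda>x. xpow \<alpha> x * w x)"
    and w: "\<And>x. 0 \<le> w x" "w \<in> borel_measurable lebesgue"
    and sq: "\<And>q. 0 \<le> riesz y (q * q)"
    and dom: "\<And>q. riesz y (q * q) \<le> riesz (moments B w) (q * q)"
    and S: "compact S"
    and loc: "\<And>j q. j \<in> {1..m} \<Longrightarrow> 0 \<le> riesz y (g j * (q * q))"
    and f: "\<And>x. x \<in> S \<Longrightarrow> 0 \<le> peval f x"
    and K: "semialg m g \<in> sets lebesgue" "semialg m g \<subseteq> B"
  shows "riesz y f \<le> (LINT x:semialg m g|lebesgue. peval f x * w x)"
proof -
  let ?G = "\<lambda>x. \<Sum>j=1..m. (max 0 (- peval (g j) x))\<^sup>2"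
  have f_int: "set_integrable lebesgue B (\<lambda>x. peval f x * w x)"
    by (rule set_integrable_peval[OF B(1) subset_refl int])
  have G_cont: "continuous_on UNIV ?G"
    by (intro continuous_intros)
  have G_zero: "?G x = 0 \<longleftrightarrow> x \<in> semialg m g" for x
    by (auto simp: semialg_def sum_nonneg_eq_0_iff max_def)
  have G_nonneg: "0 \<le> ?G x" for x
    by (intro sum_nonneg zero_le_power2)
  note lim = penalized_integral_tendsto[OF B(1) K f_int w(2) continuous_on_peval G_cont G_nonneg G_zero]
  have bound: "riesz y f \<le> (LINT x:B|lebesgue. peval f x / (1 + real k * ?G x) * w x)" for k
    by (rule dominated_riesz_le_penalized_integral[OF B int w(1) sq dom S loc f lim(1)])
  show ?thesis
    by (rule LIMSEQ_le_const[OF lim(2)]) (intro exI allI impI bound)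
qed

section \<open>The feasible sets\<close>

text \<open>
  The feasible families without the normalization of the entries of degree above \<open>2 * d\<close>. These
  sets are nested in \<open>d\<close> and closed in a space that is the same for all \<open>d\<close>.
\<close>
definition Q_constraints ::
    "nat \<Rightarrow> (nat \<Rightarrow> 'n::finite rpoly) \<Rightarrow> ('n mexp \<Rightarrow> real) \<Rightarrow> nat \<Rightarrow> ('n mexp \<Rightarrow> real) set" where
  "Q_constraints m g y2 d = {y.
     psd_on (exps d) (moment_matrix y) \<and>
     psd_on (exps d) (moment_matrix (\<lambda>\<alpha>. y2 \<alpha> - y \<alpha>)) \<and>
     (\<forall>j\<in>{1..m}. psd_on (exps (d - half_deg (g j))) (localizing_matrix (g j) y))}"

lemma Q_feasible_eq: "Q_feasible m g y2 d = extensional (exps (2 * d)) \<inter> Q_constraints m g y2 d"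
  by (auto simp: Q_feasible_def Q_constraints_def)

lemma Q_constraints_mono:
  assumes "d \<le> e"
  shows "Q_constraints m g y2 e \<subseteq> Q_constraints m g y2 d"
proof
  fix y assume y: "y \<in> Q_constraints m g y2 e"
  have "exps (d - half_deg (g j)) \<subseteq> exps (e - half_deg (g j))" for j
    using assms by (intro exps_mono) simp
  then show "y \<in> Q_constraints m g y2 d"
    using y exps_mono[OF assms] psd_on_subset[OF _ _ finite_exps]
    unfolding Q_constraints_def by blast
qed

lemma psd_on_cong:
  assumes "\<And>i j. i \<in> I \<Longrightarrow> j \<in> I \<Longrightarrow> A i j = A' i j"
  shows "psd_on I A \<longleftrightarrow> psd_on I A'"
proof -
  have "(\<Sum>i\<in>I. \<Sum>j\<in>I. v i * A i j * v j) = (\<Sum>i\<in>I. \<Sum>j\<in>I. v i * A' i j * v j)" for v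
    using assms by (intro sum.cong refl) simp
  moreover have "(\<forall>i\<in>I. \<forall>j\<in>I. A i j = A j i) \<longleftrightarrow> (\<forall>i\<in>I. \<forall>j\<in>I. A' i j = A' j i)"
    using assms by metis
  ultimately show ?thesis
    unfolding psd_on_def by simp
qed

lemma Q_constraints_cong:
  assumes eq: "\<And>\<alpha>. \<alpha> \<in> exps (2 * d) \<Longrightarrow> y \<alpha> = z \<alpha>"
    and deg: "\<And>j. j \<in> {1..m} \<Longrightarrow> half_deg (g j) \<le> d"
    and z: "z \<in> Q_constraints m g y2 d"
  shows "y \<in> Q_constraints m g y2 d"
proof -
  have "\<alpha> + \<beta> \<in> exps (2 * d)" if "\<alpha> \<in> exps d" "\<beta> \<in> exps d" for \<alpha> \<beta> :: "'a mexp"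
    using that by (simp add: exps_def mdeg_add)
  then have "psd_on (exps d) (moment_matrix y)"
    "psd_on (exps d) (moment_matrix (\<lambda>\<alpha>. y2 \<alpha> - y \<alpha>))"
    using z psd_on_cong[of "exps d" "moment_matrix y" "moment_matrix z"]
      psd_on_cong[of "exps d" "moment_matrix (\<lambda>\<alpha>. y2 \<alpha> - y \<alpha>)" "moment_matrix (\<lambda>\<alpha>. y2 \<alpha> - z \<alpha>)"]
    by (auto simp: Q_constraints_def moment_matrix_def eq)
  moreover have "psd_on (exps (d - half_deg (g j))) (localizing_matrix (g j) y)" if j: "j \<in> {1..m}" for j
  proof -
    have "localizing_matrix (g j) y \<alpha> \<beta> = localizing_matrix (g j) z \<alpha> \<beta>"
      if "\<alpha> \<in> exps (d - half_deg (g j))" "\<beta> \<in> exps (d - half_deg (g j))" for \<alpha> \<beta>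
      unfolding localizing_matrix_def
      using keys_localizing_subset_exps[OF deg[OF j] that] by (intro riesz_cong eq) blast
    then have "psd_on (exps (d - half_deg (g j))) (localizing_matrix (g j) y)
        \<longleftrightarrow> psd_on (exps (d - half_deg (g j))) (localizing_matrix (g j) z)"
      by (rule psd_on_cong)
    then show ?thesis
      using z j by (simp add: Q_constraints_def)
  qed
  ultimately show ?thesis
    by (simp add: Q_constraints_def)
qed

text \<open>
  The diagonal of the moment matrix lies between \<open>0\<close> and that of \<open>y2\<close>, and the diagonal bounds
  the other entries.
\<close>
lemma Q_constraints_bounded:
  assumes y: "y \<in> Q_constraints m g y2 d" and \<gamma>: "\<gamma> \<in> exps (2 * d)"
    and M: "\<And>\<alpha>. y2 (\<alpha> + \<alpha>) \<le> M"
  shows "\<bar>y \<gamma>\<bar> \<le> M"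
proof -
  obtain \<alpha> \<beta> where ab: "\<gamma> = \<alpha> + \<beta>" "\<alpha> \<in> exps d" "\<beta> \<in> exps d"
    using \<gamma> exponent_split[of \<gamma> d d] by (auto simp: exps_def)
  have "moment_matrix y \<delta> \<delta> \<le> M" if "\<delta> \<in> exps d" for \<delta>
    using psd_on_diagonal_nonneg[OF _ that finite_exps, of "moment_matrix (\<lambda>\<alpha>. y2 \<alpha> - y \<alpha>)"]
      y M[of \<delta>] by (simp add: Q_constraints_def moment_matrix_def)
  then have "\<bar>moment_matrix y \<alpha> \<beta>\<bar> \<le> M"
    using y ab by (intro psd_on_offdiagonal_bound[OF _ ab(2,3) finite_exps])
      (auto simp: Q_constraints_def)
  then show ?thesis
    by (simp add: moment_matrix_def ab)
qed

text \<open>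
  Tychonoff's theorem for the product topology on a function type.
\<close>
lemma compact_PiE_UNIV:
  fixes S :: "'i \<Rightarrow> 'b::topological_space set"
  assumes "\<And>i. compact (S i)"
  shows "compact (PiE UNIV S)"
  using compactin_PiE[of "\<lambda>_. euclidean" UNIV S] assms
  by (simp add: euclidean_product_topology)

lemma closed_psd_on:
  fixes A :: "'b::topological_space \<Rightarrow> 'i \<Rightarrow> 'i \<Rightarrow> real"
  assumes "\<And>i j. continuous_on UNIV (\<lambda>y. A y i j)"
  shows "closed {y. psd_on I (A y)}"
proof -
  have "{y. psd_on I (A y)} = (\<Inter>i\<in>I. \<Inter>j\<in>I. {y. A y i j = A y j i})
      \<inter> (\<Inter>v. {y. 0 \<le> (\<Sum>i\<in>I. \<Sum>j\<in>I. v i * A y i j * v j)})"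
    unfolding psd_on_def by blast
  then show ?thesis
    using assms
    by (auto intro!: closed_Int closed_INT closed_Collect_eq closed_Collect_le continuous_intros)
qed

lemma continuous_on_riesz: "continuous_on UNIV (\<lambda>y. riesz y p)"
  unfolding riesz_def
  by (intro continuous_on_sum continuous_on_mult continuous_on_const continuous_on_product_coordinates)

lemma closed_Q_constraints: "closed (Q_constraints m g y2 d)"
proof -
  have "Q_constraints m g y2 d = {y. psd_on (exps d) (moment_matrix y)}
      \<inter> {y. psd_on (exps d) (moment_matrix (\<lambda>\<alpha>. y2 \<alpha> - y \<alpha>))}
      \<inter> (\<Inter>j\<in>{1..m}. {y. psd_on (exps (d - half_deg (g j))) (localizing_matrix (g j) y)})"
    unfolding Q_constraints_def by blast
  moreover have "closed {y :: 'a mexp \<Rightarrow> real. psd_on (exps d) (moment_matrix y)}"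
    by (intro closed_psd_on) (simp add: moment_matrix_def)
  moreover have "closed {y :: 'a mexp \<Rightarrow> real. psd_on (exps d) (moment_matrix (\<lambda>\<alpha>. y2 \<alpha> - y \<alpha>))}"
    by (intro closed_psd_on)
      (simp add: moment_matrix_def continuous_on_diff[OF continuous_on_const continuous_on_product_coordinates])
  moreover have "closed {y. psd_on (exps (d - half_deg (g j))) (localizing_matrix (g j) y)}" for j
    by (intro closed_psd_on) (simp add: localizing_matrix_def continuous_on_riesz)
  ultimately show ?thesis
    by (simp add: closed_Int closed_INT)
qed

text \<open>
  Restricting the measure to \<open>K\<close> gives a family that is feasible at every order, which bounds
  the optimal values from below.
\<close>
lemma moment_sequence_mem_Q_constraints:
  fixes g :: "nat \<Rightarrow> 'n::finite rpoly" and w :: "real^'n \<Rightarrow> real"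
  assumes B: "B \<in> sets lebesgue" and K: "K \<in> sets lebesgue" "K \<subseteq> B" "K \<subseteq> semialg m g"
    and int: "\<And>\<alpha>. set_integrable lebesgue B (\<lambda>x. xpow \<alpha> x * w x)"
    and w: "\<And>x. 0 \<le> w x"
  shows "moments K w \<in> Q_constraints m g (moments B w) d"
proof -
  have psdI: "psd_on I (moment_matrix y)" if "\<And>q. 0 \<le> riesz y (q * q)" for I and y :: "'n mexp \<Rightarrow> real"
    using that by (simp add: psd_on_moment_matrix quadratic_form_eq_riesz_square[unfolded moment_matrix_def])
  note K_eq = riesz_moments[OF K(1,2) int] and B_eq = riesz_moments[OF B subset_refl int]
  have "0 \<le> riesz (moments K w) (q * q)" for q
    unfolding K_eq set_lebesgue_integral_def using w
    by (intro Bochner_Integration.integral_nonneg) (simp add: peval_mult)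
  moreover have "0 \<le> riesz (\<lambda>\<alpha>. moments B w \<alpha> - moments K w \<alpha>) (q * q)" for q
  proof -
    have "(LINT x:K|lebesgue. peval (q * q) x * w x) \<le> (LINT x:B|lebesgue. peval (q * q) x * w x)"
      unfolding set_lebesgue_integral_def
    proof (rule integral_mono)
      show "integrable lebesgue (\<lambda>x. indicat_real K x *\<^sub>R (peval (q * q) x * w x))"
        using set_integrable_peval[OF K(1,2) int] unfolding set_integrable_def .
      show "integrable lebesgue (\<lambda>x. indicat_real B x *\<^sub>R (peval (q * q) x * w x))"
        using set_integrable_peval[OF B subset_refl int] unfolding set_integrable_def .
    qed (use w K(2) in \<open>auto simp: peval_mult indicator_def\<close>)
    then show ?thesis
      by (simp add: riesz_functional_diff K_eq B_eq)
  qed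
  moreover have "0 \<le> riesz (moments K w) (g j * (q * q))" if "j \<in> {1..m}" for j q
  proof -
    have "0 \<le> indicat_real K x *\<^sub>R (peval (g j * (q * q)) x * w x)" for x
      using K(3) w[of x] that by (auto simp: indicator_def peval_mult semialg_def)
    then show ?thesis
      unfolding K_eq set_lebesgue_integral_def by (rule Bochner_Integration.integral_nonneg)
  qed
  ultimately show ?thesis
    unfolding Q_constraints_def localizing_matrix_eq_moment_matrix
    by (auto intro!: psdI simp: riesz_localized)
qed

text \<open>
  A bound that is the same for all exponents, which puts all the feasible families into a single
  compact product of intervals.
\<close>
lemma moments_double_le_mass:
  fixes w :: "real^'n::finite \<Rightarrow> real"
  assumes B: "B \<subseteq> {x. \<forall>i. x $ i \<in> {-1..1}}"
    and int: "\<And>\<alpha>. set_integrable lebesgue B (\<lambda>x. xpow \<alpha> x * w x)"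
    and w: "\<And>x. 0 \<le> w x"
  shows "moments B w (\<alpha> + \<alpha>) \<le> moments B w 0"
  unfolding moments_def
proof (rule set_integral_mono[OF int int])
  fix x assume "x \<in> B"
  then have "\<bar>x $ i\<bar> \<le> 1" for i
    using B by (auto simp: abs_le_iff)
  then have "\<bar>xpow \<alpha> x\<bar> \<le> 1"
    unfolding xpow_def abs_prod by (intro prod_le_1) (auto simp: power_abs intro!: power_le_one)
  then have "xpow \<alpha> x * xpow \<alpha> x \<le> 1"
    using abs_le_square_iff[of "xpow \<alpha> x" 1] by (simp add: power2_eq_square)
  then show "xpow (\<alpha> + \<alpha>) x * w x \<le> xpow 0 x * w x"
    using mult_right_mono[OF _ w, of _ 1 x] by (simp add: xpow_add)
qed

lemma compact_box: "compact {x :: real^'n::finite. \<forall>i. x $ i \<in> {-1..1}}"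
proof -
  have "{x :: real^'n. \<forall>i. x $ i \<in> {-1..1}} = cbox (- 1) 1"
    by (auto simp: mem_box_cart)
  then show ?thesis by (simp only: compact_cbox)
qed

section \<open>Solvability and convergence\<close>

theorem theorem3p7:
  fixes m :: nat
    and g :: "nat \<Rightarrow> 'n::finite rpoly"
    and f :: "'n rpoly"
    and B :: "(real^'n) set"
    and w :: "real^'n \<Rightarrow> real"
  defines "K \<equiv> semialg m g"
    and "y2 \<equiv> moments B w"
    and "d0 \<equiv> Max (half_deg ` insert f (g ` {1..m}))"
  assumes "compact K"
    and "\<exists>a. ball_poly a \<in> quadratic_module m g"
    and "K \<subseteq> B"
    and "B \<subseteq> {x. \<forall>i. x $ i \<in> {-1..1}}"
    and "B \<in> sets borel"
    and "w \<in> borel_measurable lebesgue"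
    and "\<And>x. 0 \<le> w x"
    and "\<And>\<alpha>. set_integrable lebesgue B (\<lambda>x. xpow \<alpha> x * w x)"
    and "\<And>x. 0 \<le> peval f x"
  shows "(\<forall>d\<ge>d0. \<exists>y1. Q_solution m g y2 f d y1) \<and>
    antimono_on {d0..} (Q_value m g y2 f) \<and>
    Q_value m g y2 f \<longlonglongrightarrow> (LINT x:K|lebesgue. peval f x * w x)"
proof -
  let ?J = "LINT x:K|lebesgue. peval f x * w x"
  let ?C = "Q_constraints m g y2"
  define M where "M = moments B w 0"
  note int = assms(11) and w = assms(10)
  have B: "B \<in> sets lebesgue"
    using assms(8) by simp
  have K: "K \<in> sets lebesgue"
    using assms(4) by (simp add: compact_imp_closed)
  have deg_f: "half_deg f \<le> d" and deg_g: "\<And>j. j \<in> {1..m} \<Longrightarrow> half_deg (g j) \<le> d" if "d0 \<le> d" for d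
    using that unfolding d0_def by auto
  have bounded: "\<bar>y \<gamma>\<bar> \<le> M" if "y \<in> ?C d" "\<gamma> \<in> exps (2 * d)" for y d \<gamma>
    unfolding M_def
    by (rule Q_constraints_bounded[OF that])
      (simp add: y2_def moments_double_le_mass[OF assms(7) int w])
  have truncate: "restrict y (exps (2 * d)) \<in> Q_feasible m g y2 d"
    "riesz (restrict y (exps (2 * d))) f = riesz y f" if "d0 \<le> d" "y \<in> ?C d" for d y
    using that(2) Q_constraints_cong[of d "restrict y (exps (2 * d))" y m g] deg_g[OF that(1)]
      keys_subset_exps[OF deg_f[OF that(1)]]
    by (auto simp: Q_feasible_eq intro!: riesz_cong)
  have K_mem: "moments K w \<in> ?C d" for d
    unfolding y2_def by (rule moment_sequence_mem_Q_constraints[OF B K assms(6) _ int w]) (simp add: K_def)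
  have K_value: "riesz (moments K w) f = ?J"
    by (rule riesz_moments[OF K assms(6) int])
  have attained: "\<exists>y1\<in>Q_feasible m g y2 d. \<forall>y\<in>Q_feasible m g y2 d. riesz y f \<le> riesz y1 f"
    if d: "d0 \<le> d" for d
  proof -
    \<comment> \<open>The feasible set is closed in a compact product, where extensionality pins the entries of
      degree above \<open>2 * d\<close> to a single value.\<close>
    let ?S = "PiE UNIV (\<lambda>\<gamma> :: 'n mexp. if \<gamma> \<in> exps (2 * d) then {-M..M} else {undefined})"
    have "Q_feasible m g y2 d = ?S \<inter> ?C d"
    proof
      show "Q_feasible m g y2 d \<subseteq> ?S \<inter> ?C d"
        using bounded[of _ d] by (auto simp: Q_feasible_eq extensional_def abs_le_iff) force+
      show "?S \<inter> ?C d \<subseteq> Q_feasible m g y2 d"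
        by (auto simp: Q_feasible_eq extensional_def PiE_iff split: if_splits)
    qed
    moreover have "compact ?S"
      by (rule compact_PiE_UNIV) simp
    ultimately have "compact (Q_feasible m g y2 d)"
      by (simp only: compact_Int_closed[OF _ closed_Q_constraints])
    moreover have "Q_feasible m g y2 d \<noteq> {}"
      using truncate(1)[OF d K_mem] by blast
    moreover have "continuous_on (Q_feasible m g y2 d) (\<lambda>y. riesz y f)"
      by (rule continuous_on_subset[OF continuous_on_riesz subset_UNIV])
    ultimately show ?thesis
      by (rule continuous_attains_sup)
  qed
  have solvable: "\<exists>y1. Q_solution m g y2 f d y1" if "d0 \<le> d" for d
    using attained[OF that] by (auto simp: Q_solution_def is_arg_max_def not_less)
  have optimum: "\<exists>y1\<in>?C d. riesz y1 f = Q_value m g y2 f d" if d: "d0 \<le> d" for d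
  proof -
    obtain y1 where "y1 \<in> Q_feasible m g y2 d"
      "\<And>y. y \<in> Q_feasible m g y2 d \<Longrightarrow> riesz y f \<le> riesz y1 f"
      using attained[OF d] by blast
    then show ?thesis
      unfolding Q_value_def Q_feasible_eq
      by (intro bexI[of _ y1] cSup_eq_maximum[symmetric]) auto
  qed
  have upper: "riesz y f \<le> Q_value m g y2 f d" if "d0 \<le> d" "y \<in> ?C d" for d y
  proof -
    from attained[OF that(1)] obtain y1 where "y1 \<in> Q_feasible m g y2 d"
      "\<And>y. y \<in> Q_feasible m g y2 d \<Longrightarrow> riesz y f \<le> riesz y1 f"
      by blast
    then have "bdd_above ((\<lambda>y. riesz y f) ` Q_feasible m g y2 d)"
      by (intro bdd_aboveI2)
    then show ?thesis
      unfolding Q_value_def using cSUP_upper[OF truncate(1)[OF that]] truncate(2)[OF that] by metis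
  qed
  have antimono: "Q_value m g y2 f e \<le> Q_value m g y2 f d" if "d0 \<le> d" "d \<le> e" for d e
  proof -
    from that have "d0 \<le> e" by simp
    from optimum[OF this] obtain y1 where "y1 \<in> ?C e" "riesz y1 f = Q_value m g y2 f e"
      by blast
    then show ?thesis
      using upper[OF that(1), of y1] Q_constraints_mono[OF that(2)] by auto
  qed
  have lower: "?J \<le> Q_value m g y2 f d" if "d0 \<le> d" for d
    using upper[OF that K_mem] by (simp add: K_value)
  have "decseq (\<lambda>n. Q_value m g y2 f (n + d0))"
    by (intro decseq_SucI antimono) auto
  then obtain V where V: "(\<lambda>n. Q_value m g y2 f (n + d0)) \<longlonglongrightarrow> V"
    "\<And>n. V \<le> Q_value m g y2 f (n + d0)"
    using decseq_convergent[of "\<lambda>n. Q_value m g y2 f (n + d0)" ?J] lower by (metis le_add2)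
  \<comment> \<open>By compactness one family satisfies the constraints of all orders with objective at least the
    limit \<open>V\<close>; a finite set of orders is served by an optimum of the largest, extended by zero.\<close>
  let ?S = "PiE UNIV (\<lambda>\<gamma> :: 'n mexp. {-M..M})"
  let ?F = "\<lambda>n. ?C (n + d0) \<inter> {y. V \<le> riesz y f}"
  have "?S \<inter> (\<Inter>n\<in>UNIV. ?F n) \<noteq> {}"
  proof (rule compact_imp_fip_image)
    show "compact ?S"
      by (rule compact_PiE_UNIV) simp
    show "closed (?F n)" for n
      by (intro closed_Int closed_Q_constraints closed_Collect_le continuous_on_const continuous_on_riesz)
    fix I :: "nat set" assume I: "finite I"
    define N where "N = Max (insert 0 I)"
    obtain y1 where y1: "y1 \<in> ?C (N + d0)" "riesz y1 f = Q_value m g y2 f (N + d0)"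
      using optimum[of "N + d0"] by auto
    define y where "y = (\<lambda>\<gamma>. if \<gamma> \<in> exps (2 * (N + d0)) then y1 \<gamma> else 0)"
    have "y \<in> ?C (N + d0)"
      using deg_g[of "N + d0"] by (intro Q_constraints_cong[OF _ _ y1(1)]) (auto simp: y_def)
    then have "y \<in> ?C (n + d0)" if "n \<in> I" for n
      using that I Q_constraints_mono[of "n + d0" "N + d0"] by (auto simp: N_def)
    moreover have "riesz y f = riesz y1 f"
      using keys_subset_exps[OF deg_f[of "N + d0"]] by (intro riesz_cong) (auto simp: y_def)
    moreover have "0 \<le> M"
      using bounded[OF y1(1), of 0] by (simp add: exps_def mdeg_def)
    then have "y \<in> ?S"
      using bounded[OF y1(1)] by (auto simp: y_def abs_le_iff) force+
    ultimately show "?S \<inter> (\<Inter>n\<in>I. ?F n) \<noteq> {}"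
      using V(2)[of N] y1(2) by auto
  qed
  then obtain y where y: "\<And>n. y \<in> ?C (n + d0)" "V \<le> riesz y f"
    by blast
  have y_mem: "y \<in> ?C d" for d
    using y(1)[of d] Q_constraints_mono[of d "d + d0" m g y2] by auto
  have psd: "psd_on (exps d) (moment_matrix y)"
    "psd_on (exps d) (moment_matrix (\<lambda>\<alpha>. y2 \<alpha> - y \<alpha>))" for d
    using y_mem[of d] by (simp_all add: Q_constraints_def)
  have psd_loc: "psd_on (exps d) (localizing_matrix (g j) y)" if j: "j \<in> {1..m}" for j d
  proof -
    have "psd_on (exps (d + half_deg (g j) - half_deg (g j))) (localizing_matrix (g j) y)"
      using y_mem[of "d + half_deg (g j)"] j unfolding Q_constraints_def by blast
    then show ?thesis by simp
  qed
  have "riesz y f \<le> ?J"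
    unfolding K_def
  proof (rule dominated_riesz_le_integral_semialg[OF B assms(7) int w assms(9) _ _ compact_box])
    show "0 \<le> riesz y (q * q)" for q
      using psd(1) psd_on_moment_matrix_iff_riesz_square by blast
    show "riesz y (q * q) \<le> riesz (moments B w) (q * q)" for q
    proof -
      have "0 \<le> riesz (\<lambda>\<alpha>. y2 \<alpha> - y \<alpha>) (q * q)"
        using psd(2) psd_on_moment_matrix_iff_riesz_square by blast
      then show ?thesis
        by (simp add: riesz_functional_diff y2_def)
    qed
    show "0 \<le> riesz y (g j * (q * q))" if "j \<in> {1..m}" for j q
    proof -
      have "0 \<le> riesz (\<lambda>\<alpha>. riesz y (g j * Poly_Mapping.single \<alpha> 1)) (q * q)"
        using psd_loc[OF that] psd_on_moment_matrix_iff_riesz_square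
        unfolding localizing_matrix_eq_moment_matrix by blast
      then show ?thesis
        by (simp only: riesz_localized)
    qed
  qed (use assms(6,12) K in \<open>auto simp: K_def\<close>)
  with y(2) have "V \<le> ?J" by simp
  moreover have "?J \<le> V"
    using V(1) lower by (intro LIMSEQ_le_const[OF V(1)]) auto
  ultimately have "Q_value m g y2 f \<longlonglongrightarrow> ?J"
    using LIMSEQ_offset[OF V(1)] by simp
  then show ?thesis
    using solvable antimono by (auto simp: monotone_on_def)
qed

end
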